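(* Let $\Lambda=(\Lambda_1,\dots,\Lambda_s)$ be a composition of $n$ and $\lambda=\mathrm{sort}(\Lambda)$; let $\Lambda^*=(\Lambda_1,\dots,\Lambda_{s-1})$ and $\lambda^*=\mathrm{sort}(\Lambda^* )$. For every partition $\mu$ of $n$ with $\lambda\trianglelefteq\mu'$, \[ \mathrm{F}_{\mu\Lambda}(q)=\sum_{\nu}\mathrm{G}^*(\mu,\nu,\Lambda_s)\,\mathrm{F}_{\nu\Lambda^*}(q), \] the sum over partitions $\nu$ of $n-\Lambda_s$ with $\lambda^*\trianglelefteq\nu'$ such that $\mu$ is $(\nu,\Lambda_s)$-eligible, where $\mathrm{G}^*(\mu,\nu,\Lambda_s)$ is the number of $(\mu,\nu,\Lambda_s)$-admissible matrices.
   Context: Work over $\mathbb{F}_q$, $q$ a prime power. For a composition $\Lambda$, $\mathfrak{u}_\Lambda(\mathbb{F}_q)$ is the nilradical of the standard parabolic subalgebra of $\mathfrak{gl}_n(\mathbb{F}_q)$ with diagonal blocks of sizes $\Lambda_1,\dots,\Lambda_s$; $J_\mu$ is the nilpotent Jordan matrix of type $\mu$ (upper triangular blocks); $\mathcal{C}_\mu$ its conjugacy class under $\mathrm{GL}$ of the appropriate size; $\mathrm{F}_{\mu\Lambda}(q)=|\mathcal{C}_\mu\cap\mathfrak{u}_\Lambda(\mathbb{F}_q)|$. $\mathrm{sort}$ sorts parts decreasingly, $'$ denotes conjugate, $\trianglelefteq$ dominance. For $1\le m\le n$ and $\nu\vdash n-m$, an $(n-m)\times m$ matrix $Z$ is $(\mu,\nu,m)$-admissible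 if $\begin{pmatrix}J_\nu&Z\\0&0_{m\times m}\end{pmatrix}\in\mathcal{C}_\mu$, and $\mu$ is $(\nu,m)$-eligible if such a $Z$ exists. *)

theory Defs
  imports "Jordan_Normal_Form.Jordan_Normal_Form"
begin

definition is_composition :: "nat \<Rightarrow> nat list \<Rightarrow> bool" where
  "is_composition n \<Lambda> \<longleftrightarrow> (\<forall>p \<in> set \<Lambda>. 0 < p) \<and> sum_list \<Lambda> = n"

definition is_partition :: "nat \<Rightarrow> nat list \<Rightarrow> bool" where
  "is_partition n \<mu> \<longleftrightarrow> is_composition n \<mu> \<and> sorted_wrt (\<ge>) \<mu>"

definition sort_parts :: "nat list \<Rightarrow> nat list" where
  "sort_parts \<Lambda> = rev (sort \<Lambda>)"

definition conj_partition :: "nat list \<Rightarrow> nat list" where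
  "conj_partition \<mu> = map (\<lambda>i. length (filter (\<lambda>p. i \<le> p) \<mu>)) [1..<Suc (foldr max \<mu> 0)]"

(* Only meaningful for partitions of the same number. *)
definition dominated :: "nat list \<Rightarrow> nat list \<Rightarrow> bool" (infix "\<unlhd>" 50) where
  "\<kappa> \<unlhd> \<mu> \<longleftrightarrow> (\<forall>k. sum_list (take k \<kappa>) \<le> sum_list (take k \<mu>))"

text \<open>The field with \<open>q\<close> elements is a type \<open>'a\<close> of sort \<open>{field, finite}\<close>; thus \<open>q = CARD('a)\<close>.
  Numbers depending on \<open>q\<close> take the type as an argument.\<close>

definition jordan_nilp :: "nat list \<Rightarrow> 'a :: {field, finite} mat" where
  "jordan_nilp \<mu> = jordan_matrix (map (\<lambda>p. (p, 0)) \<mu>)"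

definition conj_class :: "nat list \<Rightarrow> 'a :: {field, finite} mat set" where
  "conj_class \<mu> = {A. similar_mat A (jordan_nilp \<mu>)}"

(* For i < sum_list \<Lambda>: the position (from 0) of the diagonal block containing index i. *)
definition block_of :: "nat list \<Rightarrow> nat \<Rightarrow> nat" where
  "block_of \<Lambda> i = (LEAST k. i < sum_list (take (Suc k) \<Lambda>))"

definition parabolic :: "nat list \<Rightarrow> 'a :: {field, finite} mat set" where
  "parabolic \<Lambda> = {A \<in> carrier_mat (sum_list \<Lambda>) (sum_list \<Lambda>).
     \<forall>i < sum_list \<Lambda>. \<forall>j < sum_list \<Lambda>. block_of \<Lambda> j < block_of \<Lambda> i \<longrightarrow> A $$ (i, j) = 0}"

(* As usual for parabolic subalgebras, the nilradical is the Lie algebra of the unipotent radical,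
   that is, the kernel of the projection to the diagonal blocks; it is not the largest
   nilpotent Lie ideal, which would also contain the scalar matrices. *)
definition nilradical :: "nat list \<Rightarrow> 'a :: {field, finite} mat set" where
  "nilradical \<Lambda> = {A \<in> parabolic \<Lambda>.
     \<forall>i < sum_list \<Lambda>. \<forall>j < sum_list \<Lambda>. block_of \<Lambda> i = block_of \<Lambda> j \<longrightarrow> A $$ (i, j) = 0}"

definition F_num :: "'a :: {field, finite} itself \<Rightarrow> nat list \<Rightarrow> nat list \<Rightarrow> nat" where
  "F_num TYPE('a) \<mu> \<Lambda> = card (conj_class \<mu> \<inter> nilradical \<Lambda> :: 'a mat set)"

definition admissible :: "nat list \<Rightarrow> nat list \<Rightarrow> nat \<Rightarrow> 'a :: {field, finite} mat \<Rightarrow> bool" where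
  "admissible \<mu> \<nu> m Z \<longleftrightarrow> Z \<in> carrier_mat (sum_list \<nu>) m \<and>
     four_block_mat (jordan_nilp \<nu>) Z (0\<^sub>m m (sum_list \<nu>)) (0\<^sub>m m m) \<in> conj_class \<mu>"

definition eligible :: "'a :: {field, finite} itself \<Rightarrow> nat list \<Rightarrow> nat list \<Rightarrow> nat \<Rightarrow> bool" where
  "eligible TYPE('a) \<mu> \<nu> m \<longleftrightarrow> (\<exists>Z :: 'a mat. admissible \<mu> \<nu> m Z)"

definition G_star :: "'a :: {field, finite} itself \<Rightarrow> nat list \<Rightarrow> nat list \<Rightarrow> nat \<Rightarrow> nat" where
  "G_star TYPE('a) \<mu> \<nu> m = card {Z :: 'a mat. admissible \<mu> \<nu> m Z}"

end

theory Submission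
  imports Defs
    "HOL-Library.Cardinality"
    "Jordan_Normal_Form.Jordan_Normal_Form_Uniqueness"
    "Jordan_Normal_Form.Jordan_Normal_Form_Existence"
begin

text \<open>A matrix in the nilradical of \<open>\<Lambda>\<close> has the block form \<open>(Y, Z; 0, 0)\<close> with \<open>Y\<close> in the nilradical
  of \<open>\<Lambda>\<^sup>*\<close> and \<open>Z\<close> arbitrary. Sort these matrices by the Jordan type \<open>\<nu>\<close> of \<open>Y\<close>: conjugating \<open>Y\<close> to
  \<open>J\<^sub>\<nu>\<close> by \<open>Q\<close> replaces \<open>Z\<close> by \<open>Q Z\<close>, so the number of \<open>Z\<close> that yield type \<open>\<mu>\<close> depends on \<open>\<nu>\<close> only.
  Types \<open>\<nu>\<close> violating the dominance condition do not occur: the \<open>k\<close>-th partial sum of \<open>\<nu>'\<close> is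
  \<open>dim ker Y\<^sup>k\<close>, and this is at least the total size of any \<open>k\<close> blocks, because each further block of
  size \<open>m\<close> satisfies \<open>dim ker (Y, Z; 0, 0)\<^sup>k\<^sup>+\<^sup>1 \<ge> m + dim ker Y\<^sup>k\<close>. Over a finite field these dimension
  estimates become estimates of cardinalities of kernels.\<close>

subsection \<open>Block positions and the nilradical\<close>

lemma block_of_append:
  assumes "i < sum_list \<Lambda>"
  shows "block_of (\<Lambda> @ \<Lambda>') i = block_of \<Lambda> i" and "block_of \<Lambda> i < length \<Lambda>"
proof -
  let ?P = "\<lambda>k. i < sum_list (take (Suc k) \<Lambda>)"
  from assms have "\<Lambda> \<noteq> []" by auto
  \<comment> \<open>The last position is a witness for the \<open>LEAST\<close>, and it bounds the
    block position from above.\<close>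
  then have "?P (length \<Lambda> - 1)" using assms by simp
  then have P: "?P (block_of \<Lambda> i)" and le: "block_of \<Lambda> i \<le> length \<Lambda> - 1"
    unfolding block_of_def by (rule LeastI, rule Least_le)
  with \<open>\<Lambda> \<noteq> []\<close> show lt: "block_of \<Lambda> i < length \<Lambda>"
    by (cases \<Lambda>) auto
  have "block_of \<Lambda> i \<le> k" if "i < sum_list (take (Suc k) (\<Lambda> @ \<Lambda>'))" for k
  proof (cases "k < length \<Lambda>")
    case True
    with that have "?P k" by simp
    then show ?thesis unfolding block_of_def by (rule Least_le)
  qed (use lt in simp)
  with P lt show "block_of (\<Lambda> @ \<Lambda>') i = block_of \<Lambda> i"
    unfolding block_of_def[of "\<Lambda> @ \<Lambda>'"] by (intro Least_equality) auto
qed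

lemma block_of_snoc_last:
  assumes "sum_list \<Lambda> \<le> i" "i < sum_list \<Lambda> + m"
  shows "block_of (\<Lambda> @ [m]) i = length \<Lambda>"
  unfolding block_of_def
proof (rule Least_equality)
  fix k assume k: "i < sum_list (take (Suc k) (\<Lambda> @ [m]))"
  have "sum_list (take (Suc k) \<Lambda>) \<le> sum_list \<Lambda>"
    by (metis append_take_drop_id le_add1 sum_list_append)
  with k assms show "length \<Lambda> \<le> k"
    by (cases "k < length \<Lambda>") auto
qed (use assms in simp)

lemma block_of_mono:
  assumes "j \<le> i" "i < sum_list \<Lambda>"
  shows "block_of \<Lambda> j \<le> block_of \<Lambda> i"
proof -
  have "\<Lambda> \<noteq> []" using assms by auto
  then have "i < sum_list (take (Suc (length \<Lambda> - 1)) \<Lambda>)" using assms by simp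
  then have "i < sum_list (take (Suc (block_of \<Lambda> i)) \<Lambda>)"
    unfolding block_of_def by (rule LeastI)
  with assms show ?thesis unfolding block_of_def[of \<Lambda> j] by (intro Least_le) simp
qed

lemma nilradical_carrier: "A \<in> nilradical \<Lambda> \<Longrightarrow> A \<in> carrier_mat (sum_list \<Lambda>) (sum_list \<Lambda>)"
  by (simp add: nilradical_def parabolic_def)

text \<open>Vanishing below the diagonal blocks (\<open><\<close>) and inside them
  (\<open>=\<close>) merge into a single condition with \<open>\<le>\<close>.\<close>

lemma nilradical_iff:
  "A \<in> nilradical \<Lambda> \<longleftrightarrow> A \<in> carrier_mat (sum_list \<Lambda>) (sum_list \<Lambda>) \<and>
     (\<forall>i < sum_list \<Lambda>. \<forall>j < sum_list \<Lambda>. block_of \<Lambda> j \<le> block_of \<Lambda> i \<longrightarrow> A $$ (i, j) = 0)"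
  unfolding nilradical_def parabolic_def by (auto simp: le_less)

text \<open>Block positions grow with the index, so the zeros on and below the diagonal blocks cover
  the ordinary lower triangle and the diagonal. This gives access to the Jordan form of triangular
  matrices.\<close>

lemma nilradical_strictly_upper:
  assumes "A \<in> nilradical \<Lambda>" "i < sum_list \<Lambda>" "j \<le> i"
  shows "A $$ (i, j) = 0"
  using assms block_of_mono[of j i \<Lambda>] by (auto simp: nilradical_iff)

section \<open>Block matrices with vanishing bottom rows\<close>

text \<open>The zero blocks take their sizes from \<open>Y\<close> and \<open>Z\<close>, so the size
  of the last diagonal block need not be passed as a parameter.\<close>

definition top_block :: "'a :: zero mat \<Rightarrow> 'a mat \<Rightarrow> 'a mat" where
  "top_block Y Z = four_block_mat Y Z (0\<^sub>m (dim_col Z) (dim_col Y)) (0\<^sub>m (dim_col Z) (dim_col Z))"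

lemma top_block_carrier:
  "Y \<in> carrier_mat n n \<Longrightarrow> Z \<in> carrier_mat n m \<Longrightarrow> top_block Y Z \<in> carrier_mat (n + m) (n + m)"
  by (auto simp: top_block_def)

lemma top_block_index:
  assumes "Y \<in> carrier_mat n n" "Z \<in> carrier_mat n m" "i < n + m" "j < n + m"
  shows "top_block Y Z $$ (i, j) = (if n \<le> i then 0 else if j < n then Y $$ (i, j) else Z $$ (i, j - n))"
  using assms by (auto simp: top_block_def)

lemma top_block_inject:
  assumes Y: "Y \<in> carrier_mat n n" "Y' \<in> carrier_mat n n"
    and Z: "Z \<in> carrier_mat n m" "Z' \<in> carrier_mat n m"
    and eq: "top_block Y Z = top_block Y' Z'"
  shows "Y = Y' \<and> Z = Z'"
proof
  show "Y = Y'"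
  proof (rule eq_matI)
    fix i j assume "i < dim_row Y'" "j < dim_col Y'"
    with Y have "i < n" "j < n" by auto
    then show "Y $$ (i, j) = Y' $$ (i, j)"
      using arg_cong[OF eq, of "\<lambda>A. A $$ (i, j)"] top_block_index[OF Y(1) Z(1), of i j]
        top_block_index[OF Y(2) Z(2), of i j] by simp
  qed (use Y in auto)
  show "Z = Z'"
  proof (rule eq_matI)
    fix i j assume "i < dim_row Z'" "j < dim_col Z'"
    with Z have "i < n" "j < m" by auto
    then show "Z $$ (i, j) = Z' $$ (i, j)"
      using arg_cong[OF eq, of "\<lambda>A. A $$ (i, j + n)"] top_block_index[OF Y(1) Z(1), of i "j + n"]
        top_block_index[OF Y(2) Z(2), of i "j + n"] by simp
  qed (use Z in auto)
qed

text \<open>The bottom rows of the right factor are zero, so \<open>Z\<close> meets only zeros and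
  drops out.\<close>

lemma top_block_mult:
  fixes Y :: "'a :: semiring_0 mat"
  assumes "Y \<in> carrier_mat n n" "Y' \<in> carrier_mat n n" "Z \<in> carrier_mat n m" "Z' \<in> carrier_mat n m"
  shows "top_block Y Z * top_block Y' Z' = top_block (Y * Y') (Y * Z')"
proof -
  have "top_block Y Z * top_block Y' Z' =
    four_block_mat Y Z (0\<^sub>m m n) (0\<^sub>m m m) * four_block_mat Y' Z' (0\<^sub>m m n) (0\<^sub>m m m)"
    using assms by (simp add: top_block_def)
  also have "\<dots> = four_block_mat (Y * Y' + Z * 0\<^sub>m m n) (Y * Z' + Z * 0\<^sub>m m m)
      (0\<^sub>m m n * Y' + 0\<^sub>m m m * 0\<^sub>m m n) (0\<^sub>m m n * Z' + 0\<^sub>m m m * 0\<^sub>m m m)"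
    by (rule mult_four_block_mat) (use assms in auto)
  also have "\<dots> = four_block_mat (Y * Y') (Y * Z') (0\<^sub>m m n) (0\<^sub>m m m)"
    using assms by (intro cong_four_block_mat) auto
  finally show ?thesis using assms by (simp add: top_block_def)
qed

lemma top_block_mult_vec:
  fixes Y :: "'a :: semiring_0 mat"
  assumes "Y \<in> carrier_mat n n" "Z \<in> carrier_mat n m" "x \<in> carrier_vec n" "z \<in> carrier_vec m"
  shows "top_block Y Z *\<^sub>v (x @\<^sub>v z) = (Y *\<^sub>v x + Z *\<^sub>v z) @\<^sub>v 0\<^sub>v m"
proof -
  have "top_block Y Z *\<^sub>v (x @\<^sub>v z) =
    (Y *\<^sub>v x + Z *\<^sub>v z) @\<^sub>v (0\<^sub>m m n *\<^sub>v x + 0\<^sub>m m m *\<^sub>v z)"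
    unfolding top_block_def using assms by (subst four_block_mat_mult_vec) auto
  then show ?thesis using assms by auto
qed

text \<open>The left factor kills the last \<open>m\<close> coordinates, which gains \<open>m\<close> dimensions of kernel.\<close>

lemma top_block_pow:
  fixes Y :: "'a :: semiring_1 mat"
  assumes "Y \<in> carrier_mat n n" "Z \<in> carrier_mat n m"
  shows "top_block Y Z ^\<^sub>m Suc k = top_block (Y ^\<^sub>m k) (0\<^sub>m n m) * top_block Y Z"
proof -
  have pow: "Y ^\<^sub>m j \<in> carrier_mat n n" for j using assms by simp
  \<comment> \<open>In this closed form both upper blocks have the left factor
    \<open>Y ^\<^sub>m k\<close>, which can therefore be split off.\<close>
  have "top_block Y Z ^\<^sub>m Suc k = top_block (Y ^\<^sub>m Suc k) (Y ^\<^sub>m k * Z)"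
  proof (induct k)
    case 0
    then show ?case using assms top_block_carrier[OF assms] by simp
  next
    case (Suc k)
    have "top_block Y Z ^\<^sub>m Suc (Suc k) = top_block (Y ^\<^sub>m Suc k) (Y ^\<^sub>m k * Z) * top_block Y Z"
      using Suc by simp
    also have "\<dots> = top_block (Y ^\<^sub>m Suc k * Y) (Y ^\<^sub>m Suc k * Z)"
      by (rule top_block_mult) (use assms pow in \<open>auto simp del: pow_mat.simps\<close>)
    finally show ?case by simp
  qed
  also have "\<dots> = top_block (Y ^\<^sub>m k) (0\<^sub>m n m) * top_block Y Z"
    by (subst top_block_mult) (use assms pow in auto)
  finally show ?thesis .
qed

text \<open>The last \<open>m\<close> indices have the highest block position: their rows vanish,
  and above these rows their columns are unrestricted.\<close>

lemma nilradical_snoc: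
  "nilradical (\<Lambda> @ [m]) =
     (\<lambda>(Y, Z). top_block Y Z) ` (nilradical \<Lambda> \<times> carrier_mat (sum_list \<Lambda>) m)"
proof (intro equalityI subsetI)
  let ?N = "sum_list \<Lambda>"
  note block = block_of_append(1)[of _ \<Lambda> "[m]"] block_of_append(2)[of _ \<Lambda>]
    block_of_snoc_last[of \<Lambda> _ m]
  {
    fix A :: "'a mat" assume A: "A \<in> nilradical (\<Lambda> @ [m])"
    let ?Y = "mat ?N ?N (($$) A)" and ?Z = "mat ?N m (\<lambda>(i, j). A $$ (i, j + ?N))"
    have "A = top_block ?Y ?Z"
    proof (rule eq_matI)
      fix i j assume "i < dim_row (top_block ?Y ?Z)" "j < dim_col (top_block ?Y ?Z)"
      then have ij: "i < ?N + m" "j < ?N + m" by (auto simp: top_block_def)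
      have "A $$ (i, j) = 0" if "?N \<le> i"
      proof -
        have "block_of (\<Lambda> @ [m]) j \<le> block_of (\<Lambda> @ [m]) i"
          using that ij block by (cases "j < ?N") (auto simp: less_imp_le)
        then show ?thesis using A ij by (auto simp: nilradical_iff)
      qed
      then show "A $$ (i, j) = top_block ?Y ?Z $$ (i, j)"
        using ij by (subst top_block_index[of _ ?N _ m]) auto
    qed (use A in \<open>auto simp: top_block_def nilradical_iff\<close>)
    moreover have "?Y \<in> nilradical \<Lambda>"
      using A block by (auto simp: nilradical_iff)
    ultimately show "A \<in> (\<lambda>(Y, Z). top_block Y Z) ` (nilradical \<Lambda> \<times> carrier_mat ?N m)"
      by (intro image_eqI[of _ _ "(?Y, ?Z)"]) auto
  next
    fix A :: "'a mat" assume "A \<in> (\<lambda>(Y, Z). top_block Y Z) ` (nilradical \<Lambda> \<times> carrier_mat ?N m)"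
    then obtain Y Z where A: "A = top_block Y Z" and Y: "Y \<in> nilradical \<Lambda>"
      and Z: "Z \<in> carrier_mat ?N m" by auto
    have Yc: "Y \<in> carrier_mat ?N ?N" using Y by (rule nilradical_carrier)
    show "A \<in> nilradical (\<Lambda> @ [m])"
      unfolding nilradical_iff
    proof (intro conjI allI impI)
      show "A \<in> carrier_mat (sum_list (\<Lambda> @ [m])) (sum_list (\<Lambda> @ [m]))"
        using top_block_carrier[OF Yc Z] A by simp
      fix i j assume ij: "i < sum_list (\<Lambda> @ [m])" "j < sum_list (\<Lambda> @ [m])"
        and le: "block_of (\<Lambda> @ [m]) j \<le> block_of (\<Lambda> @ [m]) i"
      show "A $$ (i, j) = 0"
      proof (cases "i < ?N")
        case True
        \<comment> \<open>A column of the last block would have a higher block position than row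
          \<open>i\<close>, against \<open>le\<close>; hence no entry of \<open>Z\<close> is
          constrained.\<close>
        with le block ij have "j < ?N"
          by (metis linorder_not_less sum_list_append sum_list_simps(2) add_0_right sum_list.Nil)
        with True le block Y ij show ?thesis
          unfolding A by (subst top_block_index[OF Yc Z]) (auto simp: nilradical_iff)
      qed (use ij in \<open>simp add: A top_block_index[OF Yc Z]\<close>)
    qed
  }
qed

subsection \<open>Jordan types of nilpotent matrices\<close>

text \<open>Conjugation by the permutation matrix \<open>?P\<close> that exchanges the two index
  ranges; \<open>?Q\<close> is its transpose and inverse.\<close>

lemma similar_mat_diag_block_swap:
  fixes A :: "'a :: semiring_1 mat"
  assumes A: "A \<in> carrier_mat n n" and B: "B \<in> carrier_mat m m"
  shows "similar_mat (four_block_mat A (0\<^sub>m n m) (0\<^sub>m m n) B) (four_block_mat B (0\<^sub>m m n) (0\<^sub>m n m) A)"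
proof -
  let ?P = "four_block_mat (0\<^sub>m n m) (1\<^sub>m n) (1\<^sub>m m) (0\<^sub>m m n) :: 'a mat"
  let ?Q = "four_block_mat (0\<^sub>m m n) (1\<^sub>m m) (1\<^sub>m n) (0\<^sub>m n m) :: 'a mat"
  let ?AB = "four_block_mat A (0\<^sub>m n m) (0\<^sub>m m n) B"
  let ?BA = "four_block_mat B (0\<^sub>m m n) (0\<^sub>m n m) A"
  have PQ: "?P * ?Q = 1\<^sub>m (n + m)"
    by (subst mult_four_block_mat[of _ n m _ n _ m _ _ n _ m]) auto
  have QP: "?Q * ?P = 1\<^sub>m (n + m)"
    by (subst mult_four_block_mat[of _ m n _ m _ n _ _ m _ n]) (auto simp: add.commute[of n])
  have "?P * ?BA = four_block_mat (0\<^sub>m n m) A B (0\<^sub>m m n)"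
    by (subst mult_four_block_mat[of _ n m _ n _ m _ _ m _ n]) (use A B in auto)
  then have "?P * ?BA * ?Q = ?AB"
    by (simp, subst mult_four_block_mat[of _ n m _ n _ m _ _ n _ m]) (use A B in auto)
  then have eq: "?AB = ?P * ?BA * ?Q" by simp
  have "{?AB, ?BA, ?P, ?Q} \<subseteq> carrier_mat (n + m) (n + m)"
    by (intro insert_subsetI empty_subsetI; rule carrier_matI; use A B in \<open>simp add: add.commute\<close>)
  then show ?thesis by (rule similar_matI[OF _ PQ QP eq])
qed

lemma jordan_matrix_append:
  "jordan_matrix (xs @ ys) = four_block_mat (jordan_matrix xs)
     (0\<^sub>m (sum_list (map fst xs)) (sum_list (map fst ys)))
     (0\<^sub>m (sum_list (map fst ys)) (sum_list (map fst xs))) (jordan_matrix ys)"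
proof -
  have "sum_list (map (dim_row \<circ> (\<lambda>(n, a). jordan_block n a)) zs) = sum_list (map fst zs)"
    "sum_list (map (dim_col \<circ> (\<lambda>(n, a). jordan_block n a)) zs) = sum_list (map fst zs)"
    for zs :: "(nat \<times> 'a) list" by (induct zs) auto
  then show ?thesis
    by (simp add: jordan_matrix_def diag_block_mat_append dim_diag_block_mat Let_def)
qed

text \<open>Induction on \<open>xs\<close>: if \<open>ys = us @ a # vs\<close>, the rest of
  \<open>xs\<close> is rearranged to \<open>vs @ us\<close>, and swapping the diagonal blocks of
  \<open>a # vs\<close> and \<open>us\<close> yields \<open>ys\<close>. This allows Jordan blocks to
  be sorted by size.\<close>

lemma jordan_matrix_mset_cong:
  fixes xs ys :: "(nat \<times> 'a :: field) list"
  assumes "mset xs = mset ys"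
  shows "similar_mat (jordan_matrix xs) (jordan_matrix ys)"
  using assms
proof (induct xs arbitrary: ys)
  case Nil
  then show ?case by (auto intro!: similar_mat_refl[of _ "0"])
next
  case (Cons a xs)
  then obtain us vs where ys: "ys = us @ a # vs"
    by (metis list.set_intros(1) set_mset_mset split_list)
  have m: "mset xs = mset (vs @ us)"
    using Cons(2) ys by simp
  then have sim: "similar_mat (jordan_matrix xs) (jordan_matrix (vs @ us))"
    by (rule Cons(1))
  have "mset (map fst xs) = mset (map fst (vs @ us))"
    using m by (simp only: mset_map)
  then have len: "sum_list (map fst (vs @ us)) = sum_list (map fst xs)"
    by (metis sum_mset_sum_list)
  have "similar_mat (jordan_matrix ([a] @ xs)) (jordan_matrix ([a] @ (vs @ us)))"
    unfolding jordan_matrix_append[of "[a]"] len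
    by (rule similar_mat_four_block_0_0[OF similar_mat_refl[OF jordan_matrix_carrier] sim
        jordan_matrix_carrier jordan_matrix_carrier])
  moreover have "similar_mat (jordan_matrix ((a # vs) @ us)) (jordan_matrix (us @ (a # vs)))"
    unfolding jordan_matrix_append by (rule similar_mat_diag_block_swap) auto
  ultimately show ?case unfolding ys
    using similar_mat_trans[of "jordan_matrix (a # xs)"] by simp
qed

text \<open>\<open>jordan_nf\<close> forbids blocks of size 0, and parts of a partition are
  positive.\<close>

lemma conj_class_jordan_nf:
  assumes "is_partition n \<nu>" "A \<in> conj_class \<nu>"
  shows "jordan_nf A (map (\<lambda>p. (p, 0)) \<nu>)"
  using assms by (auto simp: jordan_nf_def conj_class_def jordan_nilp_def is_partition_def
      is_composition_def)

lemma jordan_nilp_carrier: "jordan_nilp \<nu> \<in> carrier_mat (sum_list \<nu>) (sum_list \<nu>)"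
  using jordan_matrix_carrier[of "map (\<lambda>p. (p, 0 :: 'a)) \<nu>"] by (simp add: jordan_nilp_def comp_def)

lemma sort_parts_partition:
  assumes "is_partition n \<nu>"
  shows "sort_parts \<nu> = \<nu>"
proof -
  have "sorted (rev \<nu>)"
    using assms by (simp add: is_partition_def sorted_wrt_rev)
  then show ?thesis
    unfolding sort_parts_def by (metis mset_rev properties_for_sort rev_swap)
qed

text \<open>The number of Jordan blocks of each positive size is computed from \<open>A\<close>
  alone, so both partitions have the same multiset of parts; being sorted, they coincide.\<close>

lemma conj_class_unique:
  fixes A :: "'a :: {field, finite} mat"
  assumes \<mu>: "is_partition n \<mu>" "A \<in> conj_class \<mu>" and \<nu>: "is_partition n' \<nu>" "A \<in> conj_class \<nu>"
  shows "\<mu> = \<nu>"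
proof -
  have len: "length (filter ((=) (k, 0 :: 'a)) (map (\<lambda>p. (p, 0)) xs)) = count (mset xs) k" for k xs
    by (induct xs) auto
  have "count (mset \<mu>) k = count (mset \<nu>) k" for k
  proof (cases "k = 0")
    case True
    with \<mu>(1) \<nu>(1) have "k \<notin> set \<mu>" "k \<notin> set \<nu>"
      by (auto simp: is_partition_def is_composition_def)
    then show ?thesis by (metis count_mset_0_iff)
  next
    case False
    then show ?thesis
      using compute_nr_of_jordan_blocks[OF conj_class_jordan_nf[OF \<mu>], of k 0]
        compute_nr_of_jordan_blocks[OF conj_class_jordan_nf[OF \<nu>], of k 0]
      unfolding len by simp
  qed
  then have "mset \<mu> = mset \<nu>" by (rule multiset_eqI)
  then have "sort_parts \<mu> = sort_parts \<nu>"
    unfolding sort_parts_def by (metis mset_sort properties_for_sort sorted_sort)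
  then show ?thesis
    using sort_parts_partition[OF \<mu>(1)] sort_parts_partition[OF \<nu>(1)] by simp
qed

text \<open>A triangular matrix has a Jordan form over any field. Here the diagonal is zero, so the
  characteristic polynomial is a power of X and every block has eigenvalue 0; sorting the block
  sizes gives \<open>\<nu>\<close>.\<close>

lemma nilradical_jordan_type:
  fixes A :: "'a :: {field, finite} mat"
  assumes A: "A \<in> nilradical \<Lambda>"
  obtains \<nu> where "is_partition (sum_list \<Lambda>) \<nu>" "A \<in> conj_class \<nu>"
proof -
  let ?N = "sum_list \<Lambda>"
  have Ac: "A \<in> carrier_mat ?N ?N" using A by (rule nilradical_carrier)
  have ut: "upper_triangular A"
    using Ac nilradical_strictly_upper[OF A] by (auto simp: upper_triangular_def)
  define js where "js = triangular_to_jnf_vector A"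
  have jnf: "jordan_nf A js"
    unfolding js_def by (rule triangular_to_jnf_vector[OF Ac ut])
  then have sim: "similar_mat A (jordan_matrix js)" and no0: "0 \<notin> fst ` set js"
    by (auto simp: jordan_nf_def)
  have "diag_mat A = replicate ?N 0"
    using Ac nilradical_strictly_upper[OF A] by (intro nth_equalityI) (auto simp: diag_mat_def)
  then have cp: "char_poly A = [:0, 1:] ^ ?N"
    using char_poly_upper_triangular[OF Ac ut] by simp
  \<comment> \<open>A block of size \<open>p\<close> contributes the p-th power of X - a to the
    characteristic polynomial; as \<open>p\<close> is positive, \<open>a\<close> is a root of a
    power of X.\<close>
  have ev: "a = 0" if "(p, a) \<in> set js" for p a
  proof -
    have "char_poly A = (\<Prod>(n, a)\<leftarrow>js. [:- a, 1:] ^ n)"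
      using char_poly_similar[OF sim] jordan_matrix_char_poly by metis
    then have "[:- a, 1:] ^ p dvd char_poly A"
      using that by (metis (no_types, lifting) case_prod_conv in_set_conv_nth length_map nth_map nth_mem prod_list_dvd)
    moreover have "p \<noteq> 0" using that no0 by force
    ultimately have "[:- a, 1:] dvd char_poly A"
      using dvd_power dvd_trans by blast
    then have "poly (char_poly A) a = 0" by (simp add: poly_eq_0_iff_dvd)
    then show "a = 0" unfolding cp by simp
  qed
  define \<nu> where "\<nu> = sort_parts (map fst js)"
  have js: "js = map (\<lambda>p. (p, 0)) (map fst js)"
    unfolding map_map by (rule map_idI[symmetric]) (use ev in force)
  have m\<nu>: "mset \<nu> = mset (map fst js)" by (simp add: \<nu>_def sort_parts_def)
  then have "mset js = mset (map (\<lambda>p. (p, 0)) \<nu>)"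
    by (subst js) (metis mset_map)
  then have "similar_mat A (jordan_nilp \<nu>)"
    unfolding jordan_nilp_def using sim jordan_matrix_mset_cong similar_mat_trans by metis
  then have mem: "A \<in> conj_class \<nu>" by (simp add: conj_class_def)
  have "sum_list \<nu> = ?N"
    using similar_matD[OF \<open>similar_mat A (jordan_nilp \<nu>)\<close>] carrier_matD(1)[OF Ac]
      carrier_matD(1)[OF jordan_nilp_carrier[of \<nu>, where ?'a = 'a]]
    by (metis carrier_matD(1) insert_subset)
  moreover have "set \<nu> = fst ` set js" using m\<nu> by (metis list.set_map set_mset_mset)
  moreover have "sorted_wrt (\<ge>) \<nu>"
    unfolding \<nu>_def sort_parts_def by (simp add: sorted_wrt_rev)
  moreover have "0 < p" if "p \<in> set \<nu>" for p
    using that no0 \<open>set \<nu> = fst ` set js\<close> by (metis gr0I)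
  ultimately have "is_partition ?N \<nu>"
    by (simp add: is_partition_def is_composition_def)
  with mem show thesis by (intro that)
qed

subsection \<open>Counting kernels\<close>

lemma card_carrier_vec: "card (carrier_vec n :: 'a :: finite vec set) = CARD('a) ^ n"
proof -
  have "bij_betw list_of_vec (carrier_vec n :: 'a vec set) {xs. set xs \<subseteq> UNIV \<and> length xs = n}"
    by (rule bij_betw_byWitness[where f' = vec_of_list])
      (auto simp: vec_list list_vec intro: carrier_vecI)
  then have "card (carrier_vec n :: 'a vec set) = card {xs :: 'a list. set xs \<subseteq> UNIV \<and> length xs = n}"
    by (rule bij_betw_same_card)
  then show ?thesis unfolding card_lists_length_eq[OF finite] .
qed

lemma finite_carrier_vec: "finite (carrier_vec n :: 'a :: finite vec set)"
  using card_carrier_vec[of n, where 'a = 'a] by (intro card_ge_0_finite) simp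

lemma finite_carrier_mat: "finite (carrier_mat nr nc :: 'a :: finite mat set)"
proof (rule finite_subset)
  let ?I = "{..<nr} \<times> {..<nc}"
  show "carrier_mat nr nc \<subseteq> mat nr nc ` (?I \<rightarrow>\<^sub>E (UNIV :: 'a set))"
  proof
    fix A :: "'a mat" assume "A \<in> carrier_mat nr nc"
    then have "A = mat nr nc (restrict (($$) A) ?I)" by (intro eq_matI) auto
    then show "A \<in> mat nr nc ` (?I \<rightarrow>\<^sub>E UNIV)" by (rule image_eqI[where f = "mat nr nc"]) simp
  qed
qed (simp add: finite_PiE)

lemma finite_mat_kernel: "finite (mat_kernel A :: 'a :: {field, finite} vec set)"
  by (rule finite_subset[OF mat_kernel_carrier finite_carrier_vec]) (rule carrier_matI[OF refl refl])

text \<open>Rank-nullity in counting form: every nonempty fibre is a translate of the kernel by some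
  preimage \<open>u\<close>.\<close>

lemma card_mult_vec_image:
  fixes A :: "'a :: {field, finite} mat"
  assumes A: "A \<in> carrier_mat nr nc"
  shows "card ((*\<^sub>v) A ` carrier_vec nc) * card (mat_kernel A) = CARD('a) ^ nc"
proof -
  let ?V = "carrier_vec nc :: 'a vec set"
  have fibre: "card {v \<in> ?V. A *\<^sub>v v = y} = card (mat_kernel A)" if "y \<in> (*\<^sub>v) A ` ?V" for y
  proof -
    from that obtain u where u: "u \<in> ?V" "y = A *\<^sub>v u" by auto
    have "bij_betw (\<lambda>v. v - u) {v \<in> ?V. A *\<^sub>v v = y} (mat_kernel A)"
    proof (rule bij_betw_byWitness[where f' = "\<lambda>v. v + u"])
      show "\<forall>v\<in>{v \<in> ?V. A *\<^sub>v v = y}. v - u + u = v"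
        using u by (auto intro!: eq_vecI)
      show "\<forall>v\<in>mat_kernel A. v + u - u = v"
        using u by (auto simp: mat_kernel[OF A] intro!: eq_vecI)
      show "(\<lambda>v. v - u) ` {v \<in> ?V. A *\<^sub>v v = y} \<subseteq> mat_kernel A"
        using u A by (auto simp: mat_kernel[OF A] mult_minus_distrib_mat_vec)
      show "(\<lambda>v. v + u) ` mat_kernel A \<subseteq> {v \<in> ?V. A *\<^sub>v v = y}"
        using u A by (auto simp: mat_kernel[OF A] mult_add_distrib_mat_vec)
    qed
    then show ?thesis by (rule bij_betw_same_card)
  qed
  have "CARD('a) ^ nc = (\<Sum>v\<in>?V. 1)" by (simp add: card_carrier_vec)
  also have "\<dots> = (\<Sum>y\<in>(*\<^sub>v) A ` ?V. \<Sum>v\<in>{v \<in> ?V. A *\<^sub>v v = y}. 1)"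
    by (rule sum.image_gen) (rule finite_carrier_vec)
  also have "\<dots> = (\<Sum>y\<in>(*\<^sub>v) A ` ?V. card (mat_kernel A))"
    by (rule sum.cong) (simp_all add: fibre)
  finally show ?thesis by simp
qed

text \<open>Both products \<open>|im| \<cdot> |ker|\<close> equal \<open>q\<^sup>n\<close>, and \<open>im (A B) \<subseteq> im A\<close>.\<close>

lemma card_mat_kernel_mult:
  fixes A B :: "'a :: {field, finite} mat"
  assumes A: "A \<in> carrier_mat n n" and B: "B \<in> carrier_mat n n"
  shows "card (mat_kernel A) \<le> card (mat_kernel (A * B))"
proof -
  let ?V = "carrier_vec n :: 'a vec set"
  let ?iA = "card ((*\<^sub>v) A ` ?V)" and ?iAB = "card ((*\<^sub>v) (A * B) ` ?V)"
  have AB: "A * B \<in> carrier_mat n n" using A B by simp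
  have "(*\<^sub>v) (A * B) ` ?V \<subseteq> (*\<^sub>v) A ` ?V"
    using A B by (auto simp: assoc_mult_mat_vec[OF A B])
  then have le: "?iAB \<le> ?iA" by (intro card_mono finite_imageI finite_carrier_vec)
  have eq: "?iA * card (mat_kernel A) = ?iAB * card (mat_kernel (A * B))"
    using card_mult_vec_image[OF A] card_mult_vec_image[OF AB] by simp
  \<comment> \<open>The image contains the image of 0, so the factor \<open>?iA\<close> can be
    cancelled.\<close>
  have "?iA > 0"
    using finite_carrier_vec[of n, where 'a = 'a] zero_carrier_vec[of n, where 'a = 'a]
    by (auto simp: card_gt_0_iff simp del: zero_carrier_vec)
  moreover have "?iA * card (mat_kernel A) \<le> ?iA * card (mat_kernel (A * B))"
    unfolding eq using le by (rule mult_le_mono1)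
  ultimately show ?thesis by simp
qed

text \<open>Every kernel vector is a linear combination of a basis, so coefficient functions on the
  basis map onto the kernel.\<close>

lemma card_mat_kernel_le:
  fixes A :: "'a :: {field, finite} mat"
  assumes A: "A \<in> carrier_mat nr nc"
  shows "card (mat_kernel A) \<le> CARD('a) ^ kernel_dim A"
proof -
  interpret kernel nr nc A by unfold_locales (rule A)
  from kernel_basis_exists[OF A] obtain B where fin: "finite B" and B: "basis B" by auto
  from B have sub: "B \<subseteq> mat_kernel A" and span: "span B = mat_kernel A"
    by (auto simp: Ker.basis_def)
  have "mat_kernel A \<subseteq> (\<lambda>a. lincomb a B) ` (B \<rightarrow>\<^sub>E UNIV)"
  proof
    fix v assume v: "v \<in> mat_kernel A"
    have "mat_kernel A = {lincomb a B |a. a \<in> B \<rightarrow> UNIV}"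
      using Ker.finite_span[OF fin] sub span by simp
    with v obtain a where "v = lincomb a B" by blast
    \<comment> \<open>Restricting the coefficients to \<open>B\<close> makes them an element of the
      finite space \<open>B \<rightarrow>\<^sub>E UNIV\<close>.\<close>
    also have "lincomb a B = lincomb (restrict a B) B"
      unfolding Ker.lincomb_def by (rule Ker.finsum_cong') (use sub in auto)
    finally show "v \<in> (\<lambda>a. lincomb a B) ` (B \<rightarrow>\<^sub>E UNIV)" 
      by (rule image_eqI[where f = "\<lambda>a. lincomb a B"]) simp
  qed
  then have "card (mat_kernel A) \<le> card (B \<rightarrow>\<^sub>E (UNIV :: 'a set))"
    using fin by (intro surj_card_le finite_PiE) auto
  also have "\<dots> = CARD('a) ^ kernel_dim A"
    using fin Ker.dim_basis[OF fin B] by (simp add: card_funcsetE)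
  finally show ?thesis .
qed

text \<open>The last \<open>m\<close> coordinates are free: \<open>x @\<^sub>v z\<close> is in the
  kernel for \<open>x\<close> in the kernel of \<open>A\<close> and any \<open>z\<close>.\<close>

lemma card_mat_kernel_top_block_zero:
  fixes A :: "'a :: {field, finite} mat"
  assumes A: "A \<in> carrier_mat n n"
  shows "CARD('a) ^ m * card (mat_kernel A) \<le> card (mat_kernel (top_block A (0\<^sub>m n m)))"
proof -
  let ?K = "mat_kernel (top_block A (0\<^sub>m n m))"
  have sub: "(\<lambda>(x, z). x @\<^sub>v z) ` (mat_kernel A \<times> carrier_vec m) \<subseteq> ?K"
    using A top_block_carrier[OF A zero_carrier_mat, of m]
    by (auto simp: mat_kernel top_block_mult_vec[OF A zero_carrier_mat])
  have "inj_on (\<lambda>(x, z). x @\<^sub>v z) (mat_kernel A \<times> carrier_vec m)"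
    using mat_kernel_carrier[OF A] by (auto simp: inj_on_def append_vec_eq[of _ n] subset_iff)
  from card_inj_on_le[OF this sub finite_mat_kernel] show ?thesis
    by (simp add: card_cartesian_product card_carrier_vec mult.commute)
qed

text \<open>First bound: in the factorization of the power, the left factor already has the required
  kernel, and a further right factor does not shrink its cardinality. Second bound: padding with
  zeros embeds one kernel in the other.\<close>

lemma card_mat_kernel_pow_top_block:
  fixes Y :: "'a :: {field, finite} mat"
  assumes Y: "Y \<in> carrier_mat n n" and Z: "Z \<in> carrier_mat n m"
  shows "CARD('a) ^ m * card (mat_kernel (Y ^\<^sub>m k)) \<le> card (mat_kernel (top_block Y Z ^\<^sub>m Suc k))"
    and "card (mat_kernel (Y ^\<^sub>m k)) \<le> card (mat_kernel (top_block Y Z ^\<^sub>m k))"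
proof -
  have pow: "Y ^\<^sub>m j \<in> carrier_mat n n" for j using Y by simp
  note T = top_block_carrier[OF Y Z]
  show "CARD('a) ^ m * card (mat_kernel (Y ^\<^sub>m k)) \<le> card (mat_kernel (top_block Y Z ^\<^sub>m Suc k))"
    unfolding top_block_pow[OF Y Z]
    by (rule order_trans[OF card_mat_kernel_top_block_zero[OF pow]
          card_mat_kernel_mult[OF top_block_carrier[OF pow zero_carrier_mat] T]])
  show "card (mat_kernel (Y ^\<^sub>m k)) \<le> card (mat_kernel (top_block Y Z ^\<^sub>m k))"
  proof (rule card_inj_on_le[OF _ _ finite_mat_kernel])
    show "inj_on (\<lambda>x. x @\<^sub>v 0\<^sub>v m) (mat_kernel (Y ^\<^sub>m k))"
      using mat_kernel_carrier[OF pow[of k]] by (auto simp: inj_on_def append_vec_eq[of _ n] subset_iff)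
    \<comment> \<open>On padded vectors \<open>Z\<close> acts on 0, so the block matrix acts as
      \<open>Y\<close> and preserves the padding.\<close>
    have "top_block Y Z ^\<^sub>m k *\<^sub>v (x @\<^sub>v 0\<^sub>v m) = (Y ^\<^sub>m k *\<^sub>v x) @\<^sub>v 0\<^sub>v m"
      if x: "x \<in> carrier_vec n" for x
      using x
    proof (induct k arbitrary: x)
      case 0
      then show ?case using carrier_matD[OF T] carrier_matD[OF Y] by simp
    next
      case (Suc k)
      have "Z *\<^sub>v 0\<^sub>v m = 0\<^sub>v n" using Z by (auto intro!: eq_vecI)
      then have "top_block Y Z ^\<^sub>m Suc k *\<^sub>v (x @\<^sub>v 0\<^sub>v m) = top_block Y Z ^\<^sub>m k *\<^sub>v ((Y *\<^sub>v x) @\<^sub>v 0\<^sub>v m)"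
        using Suc(2) T Y Z by (simp add: assoc_mult_mat_vec[of _ "n + m" "n + m" _ "n + m"]
            top_block_mult_vec[OF Y Z])
      also have "\<dots> = (Y ^\<^sub>m Suc k *\<^sub>v x) @\<^sub>v 0\<^sub>v m"
        using Suc Y by (simp add: assoc_mult_mat_vec[of _ n n _ n])
      finally show ?case .
    qed
    then show "(\<lambda>x. x @\<^sub>v 0\<^sub>v m) ` mat_kernel (Y ^\<^sub>m k) \<subseteq> mat_kernel (top_block Y Z ^\<^sub>m k)"
      by (auto simp: mat_kernel[OF pow] mat_kernel[OF pow_carrier_mat[OF T]])
  qed
qed

subsection \<open>Dominance\<close>

text \<open>Induction removes the last block. Arbitrary submultisets \<open>S\<close> are used
  because the largest blocks of \<open>\<Lambda>\<close> need not remain a sorted prefix once a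
  block is removed.\<close>

lemma nilradical_card_kernel_pow:
  fixes A :: "'a :: {field, finite} mat"
  assumes "A \<in> nilradical \<Lambda>" "S \<subseteq># mset \<Lambda>" "size S \<le> k"
  shows "CARD('a) ^ sum_mset S \<le> card (mat_kernel (A ^\<^sub>m k))"
  using assms
proof (induct \<Lambda> arbitrary: A S k rule: rev_induct)
  case Nil
  have "0\<^sub>v (sum_list []) \<in> mat_kernel (A ^\<^sub>m k)"
    using nilradical_carrier[OF Nil(1)] by (intro mat_kernelI[of _ 0 0]) auto
  then have "card (mat_kernel (A ^\<^sub>m k)) > 0"
    using finite_mat_kernel by (auto simp: card_gt_0_iff)
  then show ?case using Nil(2) by simp
next
  case (snoc m \<Lambda>)
  from snoc(2) obtain Y Z where A: "A = top_block Y Z" and Y: "Y \<in> nilradical \<Lambda>"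
    and Z: "Z \<in> carrier_mat (sum_list \<Lambda>) m"
    by (auto simp: nilradical_snoc)
  note pow = card_mat_kernel_pow_top_block[OF nilradical_carrier[OF Y] Z]
  show ?case
  proof (cases "S \<subseteq># mset \<Lambda>")
    case True
    from order_trans[OF snoc(1)[OF Y True snoc(4)] pow(2)] show ?thesis unfolding A .
  next
    case False
    \<comment> \<open>Since \<open>S\<close> fits only when \<open>m\<close> is added to
      \<open>\<Lambda>\<close>, it contains \<open>m\<close>. Removing \<open>m\<close> lowers the
      exponent \<open>k\<close> by one, matching the first bound.\<close>
    have "S - {#m#} \<subseteq># mset \<Lambda>"
      using snoc(3) by (simp add: subset_eq_diff_conv)
    with False have "m \<in># S" by (metis diff_single_trivial)
    then obtain S' where S: "S = add_mset m S'" by (metis mset_add)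
    with snoc(3,4) obtain j where k: "k = Suc j" and S': "S' \<subseteq># mset \<Lambda>" "size S' \<le> j"
      by (cases k) auto
    have "CARD('a) ^ sum_mset S = CARD('a) ^ m * CARD('a) ^ sum_mset S'"
      by (simp add: S power_add)
    also have "\<dots> \<le> CARD('a) ^ m * card (mat_kernel (Y ^\<^sub>m j))"
      using snoc(1)[OF Y S'] by simp
    also have "\<dots> \<le> card (mat_kernel (A ^\<^sub>m k))"
      unfolding A k by (rule pow(1))
    finally show ?thesis .
  qed
qed

text \<open>Double counting of the cells in the first \<open>k\<close> columns of the Young diagram:
  the row of length \<open>p\<close> has \<open>min k p\<close> of them.\<close>

lemma sum_list_take_conj_partition:
  "sum_list (take k (conj_partition \<nu>)) = (\<Sum>p\<leftarrow>\<nu>. min k p)"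
proof -
  let ?M = "foldr max \<nu> 0"
  let ?f = "\<lambda>\<nu> i :: nat. length (filter (\<lambda>p. i \<le> p) \<nu>)"
  have upt: "(\<Sum>i\<leftarrow>[1..<Suc L]. if i \<le> p then 1 else 0) = min L p" for L p :: nat
    by (induct L) auto
  have f: "(\<Sum>i\<leftarrow>[1..<Suc L]. ?f \<nu> i) = (\<Sum>p\<leftarrow>\<nu>. min L p)" for L
  proof (induct \<nu>)
    case (Cons p \<nu>)
    have "(\<Sum>i\<leftarrow>[1..<Suc L]. ?f (p # \<nu>) i)
        = (\<Sum>i\<leftarrow>[1..<Suc L]. (if i \<le> p then 1 else 0) + ?f \<nu> i)"
      by (intro arg_cong[of _ _ sum_list] map_cong) auto
    then show ?case using Cons upt by (simp only: sum_list_addf list.map sum_list.Cons)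
  qed (simp add: sum_list_0)
  have le: "p \<le> ?M" if "p \<in> set \<nu>" for p
    using that by (induct \<nu>) auto
  \<comment> \<open>The conjugate has only \<open>?M\<close> entries, hence \<open>min k ?M\<close>;
    no part exceeds \<open>?M\<close>, so the cap disappears afterwards.\<close>
  have "take k (conj_partition \<nu>) = map (?f \<nu>) [1..<Suc (min k ?M)]"
    unfolding conj_partition_def take_map
    by (intro arg_cong[of _ _ "map _"]) (cases "k \<le> ?M"; simp add: take_upt min_def del: upt_Suc)
  then have "sum_list (take k (conj_partition \<nu>)) = (\<Sum>p\<leftarrow>\<nu>. min (min k ?M) p)"
    by (simp only: f)
  also have "\<dots> = (\<Sum>p\<leftarrow>\<nu>. min k p)"
    using le by (intro arg_cong[of _ _ sum_list] map_cong refl) (fastforce simp: min_def)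
  finally show ?thesis .
qed

text \<open>The k-th partial sum of the conjugate is the kernel dimension of the k-th power of
  \<open>A\<close>; comparing it with the bound for the \<open>k\<close> largest blocks reduces to
  comparing exponents of q.\<close>

lemma nilradical_conj_class_dominated:
  fixes A :: "'a :: {field, finite} mat"
  assumes A: "A \<in> nilradical \<Lambda>" and \<nu>: "is_partition n \<nu>" "A \<in> conj_class \<nu>"
  shows "sort_parts \<Lambda> \<unlhd> conj_partition \<nu>"
  unfolding dominated_def
proof
  fix k
  have Ac: "A \<in> carrier_mat (sum_list \<Lambda>) (sum_list \<Lambda>)" using A by (rule nilradical_carrier)
  define S where "S = mset (take k (sort_parts \<Lambda>))"
  have "S \<subseteq># mset (sort_parts \<Lambda>)"
    unfolding S_def by (metis append_take_drop_id mset_append mset_subset_eq_add_left)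
  then have S: "S \<subseteq># mset \<Lambda>" "size S \<le> k" by (simp_all add: S_def sort_parts_def)
  \<comment> \<open>For eigenvalue 0 the generalized eigenspaces are the kernels of the powers of
    \<open>A\<close>.\<close>
  have "char_matrix A 0 = A" using Ac by (auto simp: char_matrix_def)
  then have "kernel_dim (A ^\<^sub>m k) = dim_gen_eigenspace A 0 k"
    by (simp add: dim_gen_eigenspace_def)
  also have "\<dots> = (\<Sum>p\<leftarrow>\<nu>. min k p)"
    unfolding dim_gen_eigenspace[OF conj_class_jordan_nf[OF \<nu>]] by (simp add: filter_map comp_def)
  finally have dim: "kernel_dim (A ^\<^sub>m k) = sum_list (take k (conj_partition \<nu>))"
    by (simp add: sum_list_take_conj_partition)
  have "CARD('a) ^ sum_mset S \<le> card (mat_kernel (A ^\<^sub>m k))"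
    by (rule nilradical_card_kernel_pow[OF A S])
  also have "\<dots> \<le> CARD('a) ^ kernel_dim (A ^\<^sub>m k)"
    by (rule card_mat_kernel_le[OF pow_carrier_mat[OF Ac]])
  finally have "CARD('a) ^ sum_mset S \<le> CARD('a) ^ kernel_dim (A ^\<^sub>m k)" .
  moreover have "1 < CARD('a)"
    using card_mono[of UNIV "{0, 1 :: 'a}"] by simp
  ultimately have "sum_mset S \<le> kernel_dim (A ^\<^sub>m k)"
    by (simp add: power_increasing_iff)
  then show "sum_list (take k (sort_parts \<Lambda>)) \<le> sum_list (take k (conj_partition \<nu>))"
    unfolding dim S_def by (simp add: sum_mset_sum_list)
qed

subsection \<open>The recursion\<close>

lemma conj_class_similar: "similar_mat A B \<Longrightarrow> A \<in> conj_class \<mu> \<longleftrightarrow> B \<in> conj_class \<mu>"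
  unfolding conj_class_def using similar_mat_trans similar_mat_sym by blast

lemma admissible_iff:
  "admissible \<mu> \<nu> m Z \<longleftrightarrow>
     Z \<in> carrier_mat (sum_list \<nu>) m \<and> top_block (jordan_nilp \<nu>) Z \<in> conj_class \<mu>"
  using carrier_matD(2)[OF jordan_nilp_carrier[of \<nu>, where 'a = 'a]]
  by (auto simp: admissible_def top_block_def)

text \<open>Conjugation by the block diagonal matrix with blocks \<open>P\<close> and the identity;
  the upper right block is recovered as \<open>P * (Q * Z) = Z\<close>.\<close>

lemma similar_mat_top_block:
  fixes Y :: "'a :: semiring_1 mat"
  assumes wit: "similar_mat_wit Y J P Q" and Y: "Y \<in> carrier_mat n n" and Z: "Z \<in> carrier_mat n m"
  shows "similar_mat (top_block Y Z) (top_block J (Q * Z))"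
proof -
  note w = similar_mat_witD2[OF Y wit]
  have "similar_mat_wit (four_block_mat Y Z (0\<^sub>m m n) (0\<^sub>m m m))
      (four_block_mat J (Q * Z) (0\<^sub>m m n) (0\<^sub>m m m))
      (four_block_mat P (0\<^sub>m n m) (0\<^sub>m m n) (1\<^sub>m m)) (four_block_mat Q (0\<^sub>m n m) (0\<^sub>m m n) (1\<^sub>m m))"
  proof (rule similar_mat_wit_four_block[OF wit similar_mat_wit_refl])
    have "P * (Q * Z) = P * Q * Z" using w Z by (intro assoc_mult_mat[symmetric]) auto
    then show "Z = P * (Q * Z) * 1\<^sub>m m" using w Z by simp
  qed (use w Y Z in auto)
  moreover have "dim_col Y = n" "dim_col J = n" "dim_col Z = m" "dim_col (Q * Z) = m"
    using w Y Z by auto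
  ultimately show ?thesis by (auto simp: similar_mat_def top_block_def)
qed

text \<open>Left multiplication by \<open>Q\<close> is a bijection onto the admissible matrices,
  with inverse left multiplication by \<open>P\<close>.\<close>

lemma card_top_block_conj_class:
  fixes Y :: "'a :: {field, finite} mat"
  assumes Y: "Y \<in> conj_class \<nu>"
  shows "card {Z \<in> carrier_mat (sum_list \<nu>) m. top_block Y Z \<in> conj_class \<mu>}
    = G_star TYPE('a) \<mu> \<nu> m"
proof -
  let ?N = "sum_list \<nu>" and ?J = "jordan_nilp \<nu> :: 'a mat"
  from Y obtain P Q where wit: "similar_mat_wit Y ?J P Q"
    by (auto simp: conj_class_def similar_mat_def)
  note wit' = similar_mat_wit_sym[OF wit]
  note J = jordan_nilp_carrier[of \<nu>, where 'a = 'a]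
  note w = similar_mat_witD2[OF J wit']
  have QP: "Q * (P * Z) = Z" "P * (Q * Z) = Z" if "Z \<in> carrier_mat ?N m" for Z
    using that w by (simp_all add: assoc_mult_mat[symmetric, of _ ?N ?N _ ?N _ m])
  have "bij_betw ((*) Q) {Z \<in> carrier_mat ?N m. top_block Y Z \<in> conj_class \<mu>}
    {Z. admissible \<mu> \<nu> m Z}"
  proof (rule bij_betw_byWitness[where f' = "(*) P"])
    show "(*) Q ` {Z \<in> carrier_mat ?N m. top_block Y Z \<in> conj_class \<mu>} \<subseteq> {Z. admissible \<mu> \<nu> m Z}"
      using w conj_class_similar[OF similar_mat_top_block[OF wit, of ?N _ m]]
      by (auto simp: admissible_iff)
    show "(*) P ` {Z. admissible \<mu> \<nu> m Z} \<subseteq> {Z \<in> carrier_mat ?N m. top_block Y Z \<in> conj_class \<mu>}"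
      using w conj_class_similar[OF similar_mat_top_block[OF wit' J]]
      by (auto simp: admissible_iff)
  qed (auto simp: QP admissible_iff)
  then show ?thesis unfolding G_star_def by (rule bij_betw_same_card)
qed

lemma finite_partitions: "finite {\<nu>. is_partition n \<nu>}"
proof (rule finite_subset)
  show "{\<nu>. is_partition n \<nu>} \<subseteq> {xs. set xs \<subseteq> {..n} \<and> length xs \<le> n}"
  proof safe
    fix \<nu> assume "is_partition n \<nu>"
    then have pos: "\<forall>p \<in> set \<nu>. 0 < p" and sum: "sum_list \<nu> = n"
      by (auto simp: is_partition_def is_composition_def)
    show "p \<le> n" if "p \<in> set \<nu>" for p
      using that sum member_le_sum_list by fast
    have "length \<nu> \<le> sum_list \<nu>" using pos by (induct \<nu>) auto
    then show "length \<nu> \<le> n" using sum by simp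
  qed
qed (simp add: finite_lists_length_le)

text \<open>The pairs \<open>(Y, Z)\<close> are grouped by the Jordan type of \<open>Y\<close>:
  existence of the type makes the groups cover everything, uniqueness makes them disjoint, and
  within a group each \<open>Y\<close> has equally many partners \<open>Z\<close>.\<close>

lemma F_num_snoc:
  "F_num TYPE('a :: {field, finite}) \<mu> (\<Lambda> @ [m]) =
    (\<Sum>\<nu> | is_partition (sum_list \<Lambda>) \<nu>. G_star TYPE('a) \<mu> \<nu> m * F_num TYPE('a) \<nu> \<Lambda>)"
proof -
  let ?N = "sum_list \<Lambda>"
  let ?U = "nilradical \<Lambda> :: 'a mat set"
  let ?tb = "\<lambda>(Y, Z). top_block Y Z :: 'a mat"
  define S where "S Y = {Z \<in> carrier_mat ?N m. top_block Y Z \<in> (conj_class \<mu> :: 'a mat set)}" for Y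
  define D where "D \<nu> = Sigma (conj_class \<nu> \<inter> ?U) S" for \<nu>
  have fin: "finite (conj_class \<nu> \<inter> ?U)" "finite (S Y)" for \<nu> Y
  proof -
    show "finite (conj_class \<nu> \<inter> ?U)"
      by (rule finite_subset[OF _ finite_carrier_mat]) (use nilradical_carrier in blast)
    show "finite (S Y)"
      by (rule finite_subset[OF _ finite_carrier_mat]) (auto simp: S_def)
  qed
  have inj: "inj_on ?tb (?U \<times> carrier_mat ?N m)"
  proof (rule inj_onI, clarify)
    fix Y Z Y' Z'
    assume "Y \<in> ?U" "Y' \<in> ?U" "Z \<in> carrier_mat ?N m" "Z' \<in> carrier_mat ?N m"
      "top_block Y Z = top_block Y' Z'"
    then show "Y = Y' \<and> Z = Z'"
      using top_block_inject[OF nilradical_carrier nilradical_carrier] by blast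
  qed
  have sub: "D \<nu> \<subseteq> ?U \<times> carrier_mat ?N m" for \<nu> by (auto simp: D_def S_def)
  have "conj_class \<mu> \<inter> nilradical (\<Lambda> @ [m]) = (\<Union>\<nu>\<in>{\<nu>. is_partition ?N \<nu>}. ?tb ` D \<nu>)"
  proof (intro equalityI subsetI)
    fix A assume A: "A \<in> conj_class \<mu> \<inter> (nilradical (\<Lambda> @ [m]) :: 'a mat set)"
    then obtain Y Z where YZ: "A = top_block Y Z" "Y \<in> ?U" "Z \<in> carrier_mat ?N m"
      by (auto simp: nilradical_snoc)
    from nilradical_jordan_type[OF YZ(2)] obtain \<nu> where "is_partition ?N \<nu>" "Y \<in> conj_class \<nu>" .
    with A YZ show "A \<in> (\<Union>\<nu>\<in>{\<nu>. is_partition ?N \<nu>}. ?tb ` D \<nu>)"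
      by (intro UN_I[of \<nu>] image_eqI[of _ _ "(Y, Z)"]) (auto simp: D_def S_def)
  next
    fix A assume "A \<in> (\<Union>\<nu>\<in>{\<nu>. is_partition ?N \<nu>}. ?tb ` D \<nu>)"
    then show "A \<in> conj_class \<mu> \<inter> nilradical (\<Lambda> @ [m])"
      by (force simp: nilradical_snoc D_def S_def)
  qed
  then have "F_num TYPE('a) \<mu> (\<Lambda> @ [m]) = card (\<Union>\<nu>\<in>{\<nu>. is_partition ?N \<nu>}. ?tb ` D \<nu>)"
    by (simp add: F_num_def)
  also have "\<dots> = (\<Sum>\<nu> | is_partition ?N \<nu>. card (?tb ` D \<nu>))"
  proof (rule card_UN_disjoint[OF finite_partitions]; intro ballI impI)
    fix \<nu> show "finite (?tb ` D \<nu>)" unfolding D_def using fin by blast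
  next
    fix \<nu> \<nu>' assume "\<nu> \<in> {\<nu>. is_partition ?N \<nu>}" "\<nu>' \<in> {\<nu>. is_partition ?N \<nu>}" "\<nu> \<noteq> \<nu>'"
    then have "D \<nu> \<inter> D \<nu>' = {}"
      using conj_class_unique[of ?N \<nu> _ ?N \<nu>', where 'a = 'a] by (auto simp: D_def)
    \<comment> \<open>Injectivity carries disjointness of the sets of pairs over to the
      matrices.\<close>
    then show "?tb ` D \<nu> \<inter> ?tb ` D \<nu>' = {}"
      using inj_on_image_Int[OF inj sub sub] by (metis image_empty)
  qed
  also have "\<dots> = (\<Sum>\<nu> | is_partition ?N \<nu>. G_star TYPE('a) \<mu> \<nu> m * F_num TYPE('a) \<nu> \<Lambda>)"
  proof (rule sum.cong[OF refl])
    fix \<nu> assume "\<nu> \<in> {\<nu>. is_partition ?N \<nu>}"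
    then have "sum_list \<nu> = ?N" by (simp add: is_partition_def is_composition_def)
    then have S: "card (S Y) = G_star TYPE('a) \<mu> \<nu> m" if "Y \<in> conj_class \<nu>" for Y
      unfolding S_def using card_top_block_conj_class[OF that] by simp
    have "card (?tb ` D \<nu>) = card (D \<nu>)"
      by (rule card_image[OF inj_on_subset[OF inj sub]])
    also have "\<dots> = (\<Sum>Y\<in>conj_class \<nu> \<inter> ?U. card (S Y))"
      unfolding D_def using fin by (intro card_SigmaI) auto
    also have "\<dots> = (\<Sum>Y\<in>conj_class \<nu> \<inter> ?U. G_star TYPE('a) \<mu> \<nu> m)"
      by (rule sum.cong) (auto simp: S)
    finally show "card (?tb ` D \<nu>) = G_star TYPE('a) \<mu> \<nu> m * F_num TYPE('a) \<nu> \<Lambda>"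
      by (simp add: F_num_def mult.commute)
  qed
  finally show ?thesis .
qed

theorem theorem4p1:
  fixes n :: nat and \<Lambda> \<mu> :: "nat list"
  assumes "is_composition n \<Lambda>" and "\<Lambda> \<noteq> []"
    and "is_partition n \<mu>" and "sort_parts \<Lambda> \<unlhd> conj_partition \<mu>"
  shows "F_num TYPE('a :: {field, finite}) \<mu> \<Lambda> =
    (\<Sum>\<nu> | is_partition (n - last \<Lambda>) \<nu> \<and> sort_parts (butlast \<Lambda>) \<unlhd> conj_partition \<nu> \<and>
            eligible TYPE('a) \<mu> \<nu> (last \<Lambda>).
       G_star TYPE('a) \<mu> \<nu> (last \<Lambda>) * F_num TYPE('a) \<nu> (butlast \<Lambda>))"
proof -
  let ?\<Lambda> = "butlast \<Lambda>" and ?m = "last \<Lambda>"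
  let ?f = "\<lambda>\<nu>. G_star TYPE('a) \<mu> \<nu> ?m * F_num TYPE('a) \<nu> ?\<Lambda>"
  have \<Lambda>: "?\<Lambda> @ [?m] = \<Lambda>" using assms(2) by simp
  have "sum_list \<Lambda> = sum_list ?\<Lambda> + ?m" by (subst \<Lambda>[symmetric]) simp
  then have N: "sum_list ?\<Lambda> = n - ?m" using assms(1) by (auto simp: is_composition_def)
  have "F_num TYPE('a) \<mu> \<Lambda> = (\<Sum>\<nu> | is_partition (n - ?m) \<nu>. ?f \<nu>)"
    using F_num_snoc[of \<mu> ?\<Lambda> ?m, where 'a = 'a] unfolding \<Lambda> N .
  also have "\<dots> = (\<Sum>\<nu> | is_partition (n - ?m) \<nu> \<and> sort_parts ?\<Lambda> \<unlhd> conj_partition \<nu> \<and>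
      eligible TYPE('a) \<mu> \<nu> ?m. ?f \<nu>)"
  proof -
    \<comment> \<open>Partitions outside the restricted range contribute 0: a nonzero
      \<open>F_num\<close> supplies a nilradical element of type \<open>\<nu>\<close>, which forces
      dominance, and a nonzero \<open>G_star\<close> supplies an admissible matrix.\<close>
    have "sort_parts ?\<Lambda> \<unlhd> conj_partition \<nu> \<and> eligible TYPE('a) \<mu> \<nu> ?m"
      if \<nu>: "is_partition (n - ?m) \<nu>" and f: "?f \<nu> \<noteq> 0" for \<nu>
    proof
      from f have "conj_class \<nu> \<inter> nilradical ?\<Lambda> \<noteq> ({} :: 'a mat set)"
        unfolding F_num_def by (metis card.empty mult_0_right)
      then obtain A :: "'a mat" where "A \<in> conj_class \<nu>" "A \<in> nilradical ?\<Lambda>" by blast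
      then show "sort_parts ?\<Lambda> \<unlhd> conj_partition \<nu>"
        by (intro nilradical_conj_class_dominated[OF _ \<nu>])
      from f have "{Z :: 'a mat. admissible \<mu> \<nu> ?m Z} \<noteq> {}"
        unfolding G_star_def by (metis card.empty mult_0)
      then show "eligible TYPE('a) \<mu> \<nu> ?m" unfolding eligible_def by blast
    qed
    then show ?thesis
      by (intro sum.mono_neutral_right finite_partitions) auto
  qed
  finally show ?thesis .
qed

end
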